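(* Let $C$ be a reduced singular plane curve of degree $d$ in $\mathbb{P}^2_{\mathbb{K}}$ ($\mathbb{K}$ algebraically closed), and let $T$ be the set of singular points of $C$. Then $H(C)<-1$ if and only if $|T|>0$ and $H(C,T)<-1$; and in this case $H(C)=H(C,U)$ for some nonempty subset $U\subseteq T$.
   Context: For a reduced plane curve $C$ of degree $d$ and a nonempty finite set $S\subseteq\mathbb{P}^2$, $H(C,S)=\frac{d^2-\sum_{p\in S}(\mathrm{mult}_pC)^2}{|S|}$, where $\mathrm{mult}_pC$ is the largest $k$ such that the defining form of $C$ lies in $I(p)^k$ (so it is $0$ for $p\notin C$). $H(C)=\inf\{H(C,S): S\subseteq\mathbb{P}^2,\ 0<|S|<\infty\}$. *)

theory Defs
  imports Complex_Main "HOL-Library.Poly_Mapping" "HOL-Computational_Algebra.Polynomial"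
begin

text \<open>Polynomials over 'k in the variables x_0, x_1, x_2 are modelled as finitely supported
  maps from monomials (exponent vectors nat =>0 nat) to coefficients; this type is a
  commutative ring (convolution product).  A polynomial is in K[x0,x1,x2] iff only the
  variables 0,1,2 occur.\<close>

type_synonym 'k mpoly = "(nat \<Rightarrow>\<^sub>0 nat) \<Rightarrow>\<^sub>0 'k"

definition in_ring3 :: "'k::comm_ring_1 mpoly \<Rightarrow> bool" where
  "in_ring3 F \<longleftrightarrow> (\<forall>m \<in> Poly_Mapping.keys F. Poly_Mapping.keys m \<subseteq> {0,1,2})"

definition homogeneous :: "nat \<Rightarrow> 'k::comm_ring_1 mpoly \<Rightarrow> bool" where
  "homogeneous d F \<longleftrightarrow> in_ring3 F \<and> (\<forall>m \<in> Poly_Mapping.keys F. Poly_Mapping.lookup m 0 + Poly_Mapping.lookup m 1 + Poly_Mapping.lookup m 2 = d)"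

definition eval3 :: "'k::comm_ring_1 mpoly \<Rightarrow> 'k \<times> 'k \<times> 'k \<Rightarrow> 'k" where
  "eval3 F p = (case p of (x, y, z) \<Rightarrow>
     (\<Sum>m \<in> Poly_Mapping.keys F. Poly_Mapping.lookup F m * x ^ Poly_Mapping.lookup m 0 * y ^ Poly_Mapping.lookup m 1 * z ^ Poly_Mapping.lookup m 2))"

text \<open>The projective plane P^2, each point represented by its unique normalized
  homogeneous coordinate vector (first nonzero coordinate equal to 1).\<close>
definition P2 :: "('k::field \<times> 'k \<times> 'k) set" where
  "P2 = {(x, y, z). x = 1 \<or> (x = 0 \<and> y = 1) \<or> (x = 0 \<and> y = 0 \<and> z = 1)}"

definition Ipt :: "'k::field \<times> 'k \<times> 'k \<Rightarrow> 'k mpoly set" where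
  "Ipt p = {f. in_ring3 f \<and> eval3 f p = 0}"

definition ideal_gen3 :: "'k::comm_ring_1 mpoly set \<Rightarrow> 'k mpoly set" where
  "ideal_gen3 G = {(\<Sum>i\<in>A. r i * g i) | (A :: nat set) r g.
      finite A \<and> (\<forall>i\<in>A. in_ring3 (r i) \<and> g i \<in> G)}"

fun ideal_pow3 :: "'k::comm_ring_1 mpoly set \<Rightarrow> nat \<Rightarrow> 'k mpoly set" where
  "ideal_pow3 I 0 = {f. in_ring3 f}"
| "ideal_pow3 I (Suc k) = ideal_gen3 {a * b | a b. a \<in> I \<and> b \<in> ideal_pow3 I k}"

definition mult :: "'k::field \<times> 'k \<times> 'k \<Rightarrow> 'k mpoly \<Rightarrow> nat" where
  "mult p F = (GREATEST k. F \<in> ideal_pow3 (Ipt p) k)"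

definition reduced :: "'k::field mpoly \<Rightarrow> bool" where
  "reduced F \<longleftrightarrow> (\<forall>g. in_ring3 g \<and> g * g dvd F \<longrightarrow> g dvd 1)"

definition sing_pts :: "'k::field mpoly \<Rightarrow> ('k \<times> 'k \<times> 'k) set" where
  "sing_pts F = {p \<in> P2. mult p F \<ge> 2}"

definition Hs :: "nat \<Rightarrow> 'k::field mpoly \<Rightarrow> ('k \<times> 'k \<times> 'k) set \<Rightarrow> real" where
  "Hs d F S = (real (d^2) - (\<Sum>p\<in>S. real ((mult p F)^2))) / real (card S)"

definition Hinf :: "nat \<Rightarrow> 'k::field mpoly \<Rightarrow> real" where
  "Hinf d F = Inf {Hs d F S | S. S \<subseteq> P2 \<and> finite S \<and> S \<noteq> {}}"

end

theory Submission
  imports Defs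
begin

text \<open>
  The numerical part is elementary: $H(C,S) < -1$ means $d^2 < \sum_{p \in S} (m_p^2 - 1)$, so
  discarding the points with $m_p \le 1$ only helps, and the infimum is a minimum over subsets of
  $T$ as soon as $T$ is finite.

  Finiteness of $T$ is shown without resultants or unique factorisation. Suppose $f \in K[y][z]$ is
  singular at infinitely many points. Among the nonzero polynomials vanishing at infinitely many of
  them take $G$ of least degree in $z$, and then with leading coefficient of least degree in $y$.
  Pseudo-division shows that $G$ divides every polynomial that vanishes at infinitely many of
  the zeros of $G$ in the set; in particular $f = G H$. If $H$ vanishes at infinitely many of these
  zeros, then $G^2$ divides $f$. Otherwise both partial derivatives of $G$ vanish at infinitely many
  of them, hence vanish identically, and $G$ is a constant or a $p$-th power, contradicting minimality.
  The line $x_0 = 0$ is treated separately, and squares are carried back from the chart $x_0 = 1$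
  by homogenisation.
\<close>

section \<open>Singular points of affine plane curves\<close>

text \<open>In \<open>'a poly poly\<close> the inner variable is $y$ and the outer one is $z$.\<close>

definition eval_inner :: "'a::comm_ring_1 \<Rightarrow> 'a poly poly \<Rightarrow> 'a poly" where
  "eval_inner a P = map_poly (\<lambda>c. poly c a) P"

definition eval2 :: "'a::comm_ring_1 poly poly \<Rightarrow> 'a \<times> 'a \<Rightarrow> 'a" where
  "eval2 P p = poly (poly P [:snd p:]) (fst p)"

lemma coeff_eval_inner [simp]: "coeff (eval_inner a P) n = poly (coeff P n) a"
  by (simp add: eval_inner_def coeff_map_poly)

lemma eval_inner_0 [simp]: "eval_inner a 0 = 0"
  by (simp add: eval_inner_def)

lemma eval_inner_pCons [simp]: "eval_inner a (pCons c P) = pCons (poly c a) (eval_inner a P)"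
  by (rule poly_eqI) (simp add: coeff_pCons split: nat.split)

lemma eval_inner_mult: "eval_inner a (P * Q) = eval_inner a P * eval_inner a Q"
  by (rule poly_eqI) (simp add: coeff_mult poly_sum)

lemma poly_eval_inner: "poly (eval_inner a P) b = eval2 P (a, b)"
  by (induction P) (simp_all add: eval2_def)

lemma eval_inner_eq_0_iff:
  fixes P :: "'a::idom poly poly"
  shows "eval_inner a P = 0 \<longleftrightarrow> [:[:-a, 1:]:] dvd P"
  by (auto simp: const_poly_dvd_iff poly_eq_0_iff_dvd [symmetric] poly_eq_iff)

lemma eval2_simps [simp]:
  "eval2 0 p = 0" "eval2 (P + Q) p = eval2 P p + eval2 Q p"
  "eval2 (P * Q) p = eval2 P p * eval2 Q p" "eval2 (smult c P) p = poly c (fst p) * eval2 P p"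
  "eval2 [:c:] p = poly c (fst p)" "eval2 (P ^ n) p = eval2 P p ^ n"
  by (simp_all add: eval2_def)

text \<open>Restriction to y = a is a ring homomorphism to a domain, with kernel generated by y -
  a.\<close>

lemma inner_linear_prime:
  fixes P Q :: "'a::idom poly poly"
  assumes "[:[:-a, 1:]:] dvd P * Q"
  shows "[:[:-a, 1:]:] dvd P \<or> [:[:-a, 1:]:] dvd Q"
  using assms by (simp add: eval_inner_eq_0_iff [symmetric] eval_inner_mult)

text \<open>Takes the place of Gauss's lemma: c splits into a constant and linear factors y - a,
  each of which is prime and does not divide G, so it divides q and cancels.\<close>

lemma dvd_cancel_inner_factor:
  fixes G h q :: "'a::alg_closed_field poly poly"
  assumes "smult c h = G * q" and "c \<noteq> 0" and "\<And>a. \<not> [:[:-a, 1:]:] dvd G"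
  shows "G dvd h"
  using assms(1,2)
proof (induction "degree c" arbitrary: c q)
  case 0
  then obtain k where k: "c = [:k:]" "k \<noteq> 0"
    by (metis degree_eq_zeroE pCons_0_0)
  have "h = smult [:inverse k:] (smult c h)"
    using k by simp (simp flip: one_pCons)
  also have "\<dots> = G * smult [:inverse k:] q"
    by (simp only: 0 mult_smult_right)
  finally show ?case by (rule dvdI)
next
  case (Suc n)
  obtain a where "poly c a = 0"
    using Suc.hyps(2) alg_closed_imp_poly_has_root [of c] by auto
  then obtain c' where c': "c = [:-a, 1:] * c'"
    by (auto simp: poly_eq_0_iff_dvd elim: dvdE)
  have "[:[:-a, 1:]:] * smult c' h = G * q"
    using Suc.prems(1) c' by simp
  then have "[:[:-a, 1:]:] dvd G * q"
    by (metis dvd_triv_left)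
  then obtain q' where q': "q = [:[:-a, 1:]:] * q'"
    using inner_linear_prime assms(3) by (blast elim: dvdE)
  have "[:[:-a, 1:]:] * smult c' h = [:[:-a, 1:]:] * (G * q')"
    using \<open>[:[:-a, 1:]:] * smult c' h = G * q\<close> q' by (simp only: mult.left_commute)
  then have "smult c' h = G * q'"
    by (subst (asm) mult_left_cancel) auto
  moreover have "c' \<noteq> 0"
    using Suc.prems(2) c' by auto
  moreover have "n = degree c'"
    using Suc.hyps(2) c' \<open>c' \<noteq> 0\<close> by (simp add: degree_mult_eq del: mult_pCons_left)
  ultimately show ?case
    using Suc.hyps(1) by blast
qed

text \<open>Only exponents divisible by p = \<open>CHAR('a)\<close> survive, and the coefficients
  are p-th powers, so additivity of the Frobenius map yields a p-th root. Applied first to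
  polynomials in y over K, then to polynomials in z over K[y].\<close>

lemma pderiv_eq_0_imp_power:
  fixes P :: "'a::idom poly"
  assumes "prime CHAR('a)" and "pderiv P = 0" and "\<And>i. \<exists>r. r ^ CHAR('a) = coeff P i"
  shows "\<exists>Q. P = Q ^ CHAR('a)"
proof -
  let ?p = "CHAR('a)"
  obtain r where r: "\<And>i. r i ^ ?p = coeff P i"
    using assms(3) by metis
  have 0: "coeff P i = 0" if ndvd: "\<not> ?p dvd i" for i
  proof -
    obtain j where j: "i = Suc j"
      using ndvd by (cases i) auto
    have "of_nat (Suc j) * coeff P (Suc j) = 0"
      using assms(2) by (metis coeff_pderiv coeff_0)
    moreover have "of_nat (Suc j) \<noteq> (0::'a)"
      using ndvd j of_nat_eq_0_iff_char_dvd by metis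
    ultimately show ?thesis
      using j by (metis mult_eq_0_iff)
  qed
  let ?I = "{i. i \<le> degree P \<and> ?p dvd i}"
  have "P = (\<Sum>i\<le>degree P. monom (coeff P i) i)"
    by (simp add: poly_as_sum_of_monoms)
  also have "\<dots> = (\<Sum>i\<in>?I. monom (coeff P i) i)"
    by (rule sum.mono_neutral_right) (auto simp: 0)
  also have "\<dots> = (\<Sum>i\<in>?I. monom (r i) (i div ?p) ^ ?p)"
    by (rule sum.cong) (auto simp: monom_power r)
  also have "\<dots> = (\<Sum>i\<in>?I. monom (r i) (i div ?p)) ^ ?p"
    by (rule freshmans_dream_sum [symmetric]) (use assms(1) in simp_all)
  finally show ?thesis by blast
qed

lemma pderiv_eq_0_imp_degree_0:
  fixes P :: "'a::idom poly"
  assumes "CHAR('a) = 0" and "pderiv P = 0"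
  shows "degree P = 0"
proof (rule ccontr)
  assume "degree P \<noteq> 0"
  then obtain n where n: "degree P = Suc n"
    using not0_implies_Suc by blast
  have "of_nat (Suc n) * coeff P (Suc n) = 0"
    using assms(2) by (metis coeff_pderiv coeff_0)
  moreover have "of_nat (Suc n) \<noteq> (0::'a)"
    using assms(1) of_nat_eq_0_iff_char_dvd [where ?'a = 'a, of "Suc n"] by simp
  ultimately have "coeff P (Suc n) = 0"
    by (metis mult_eq_0_iff)
  then show False
    using n by (metis leading_coeff_0_iff degree_0 nat.distinct(1))
qed

section \<open>Partial derivatives and double zeros\<close>

lemma degree_pderiv_less:
  fixes P :: "'a::idom poly"
  assumes "pderiv P \<noteq> 0"
  shows "degree (pderiv P) < degree P"
proof -
  have "lead_coeff (pderiv P) \<noteq> 0"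
    using assms by simp
  then have "coeff P (Suc (degree (pderiv P))) \<noteq> 0"
    by (simp only: coeff_pderiv) auto
  then show ?thesis
    using le_degree by fastforce
qed

text \<open>\<open>map_poly pderiv\<close> is the partial derivative in y, which commutes with
  setting z to a constant.\<close>

lemma poly_map_poly_pderiv:
  "poly (map_poly pderiv P) [:b:] = pderiv (poly P [:b:])" for P :: "'a::idom poly poly"
proof (induction P)
  case (pCons c P)
  have "map_poly pderiv (pCons c P) = pCons (pderiv c) (map_poly pderiv P)"
    by (rule poly_eqI) (simp add: coeff_map_poly coeff_pCons split: nat.split)
  then show ?case
    using pCons by (simp add: pderiv_add pderiv_smult)
qed simp

lemma eval_inner_pderiv: "eval_inner a (pderiv P) = pderiv (eval_inner a P)" for P :: "'a::idom poly poly"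
  by (rule poly_eqI) (simp add: coeff_pderiv del: of_nat_Suc)

text \<open>As X - a is prime and does not divide h, both factors X - a divide g, and a double root
  of g is a root of its derivative.\<close>

lemma poly_pderiv_eq_0_of_square_dvd:
  fixes g h :: "'a::field poly"
  assumes "[:-a, 1:]\<^sup>2 dvd g * h" and "poly h a \<noteq> 0"
  shows "poly (pderiv g) a = 0"
proof -
  have lin: "[:-a, 1:] dvd u" if "[:-a, 1:] dvd u * h" for u
    using that assms(2) by (simp add: poly_eq_0_iff_dvd [symmetric] poly_mult)
  have "[:-a, 1:] dvd g * h"
    using assms(1) unfolding power2_eq_square by (rule dvd_mult_left)
  then obtain u where u: "g = [:-a, 1:] * u"
    using lin by (blast elim: dvdE)
  have "[:-a, 1:] * [:-a, 1:] dvd [:-a, 1:] * (u * h)"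
    using assms(1) by (simp only: u power2_eq_square mult.assoc)
  then have "[:-a, 1:] dvd u * h"
    by (subst (asm) dvd_mult_cancel_left) auto
  then obtain k where "u = [:-a, 1:] * k"
    using lin by (blast elim: dvdE)
  then have k: "g = [:-a, 1:] * ([:-a, 1:] * k)"
    using u by (simp only:)
  show ?thesis
    unfolding k by (simp add: pderiv_mult del: mult_pCons_left)
qed

text \<open>Being singular at p, expressed through one-variable polynomials: double zeros on both
  coordinate lines through p amount to f and its two partial derivatives vanishing at p.\<close>

definition doubly_vanishes :: "'a::field poly poly \<Rightarrow> 'a \<times> 'a \<Rightarrow> bool" where
  "doubly_vanishes f p \<longleftrightarrow>
     [:-fst p, 1:]\<^sup>2 dvd poly f [:snd p:] \<and> [:-snd p, 1:]\<^sup>2 dvd eval_inner (fst p) f"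

lemma doubly_vanishes_imp_eval2: "doubly_vanishes f p \<Longrightarrow> eval2 f p = 0"
  by (auto simp: doubly_vanishes_def eval2_def poly_mult elim!: dvdE)

text \<open>Where H does not vanish, the double zeros of G * H on the two coordinate lines belong to
  G.\<close>

lemma doubly_vanishes_mult:
  assumes "doubly_vanishes (G * H) p" and "eval2 H p \<noteq> 0"
  shows "eval2 (pderiv G) p = 0" and "eval2 (map_poly pderiv G) p = 0"
proof -
  obtain a b where p: "p = (a, b)" by force
  have "[:-b, 1:]\<^sup>2 dvd eval_inner a G * eval_inner a H" "poly (eval_inner a H) b \<noteq> 0"
    using assms by (simp_all add: p doubly_vanishes_def eval_inner_mult poly_eval_inner)
  then show "eval2 (pderiv G) p = 0"
    using poly_pderiv_eq_0_of_square_dvd [of b "eval_inner a G" "eval_inner a H"]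
    by (simp add: p flip: poly_eval_inner eval_inner_pderiv)
  have "[:-a, 1:]\<^sup>2 dvd poly G [:b:] * poly H [:b:]" "poly (poly H [:b:]) a \<noteq> 0"
    using assms by (simp_all add: p doubly_vanishes_def eval2_def)
  then show "eval2 (map_poly pderiv G) p = 0"
    using poly_pderiv_eq_0_of_square_dvd by (simp add: p eval2_def poly_map_poly_pderiv)
qed

text \<open>The zero of G in the conclusion certifies that G is not a unit.\<close>

lemma infinite_singular_imp_square_dvd:
  fixes f :: "'a::alg_closed_field poly poly"
  assumes "f \<noteq> 0" and Z: "infinite Z" and sing: "\<And>p. p \<in> Z \<Longrightarrow> doubly_vanishes f p"
  shows "\<exists>G p. G * G dvd f \<and> eval2 G p = 0"
proof -
  define good where "good G \<longleftrightarrow> G \<noteq> 0 \<and> infinite {p\<in>Z. eval2 G p = 0}" for G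
  have f0: "{p\<in>Z. eval2 f p = 0} = Z"
    using sing doubly_vanishes_imp_eval2 by blast
  then have "good f"
    using assms by (simp add: good_def)
  obtain n where n: "\<exists>G. good G \<and> degree G = n" "\<And>H. good H \<Longrightarrow> n \<le> degree H"
    using ex_has_least_nat [of good f degree] \<open>good f\<close> by blast
  obtain G where G: "good G" "degree G = n"
    and min2': "\<And>H. good H \<and> degree H = n \<Longrightarrow> degree (lead_coeff G) \<le> degree (lead_coeff H)"
    using ex_has_least_nat [of "\<lambda>G. good G \<and> degree G = n" _ "\<lambda>G. degree (lead_coeff G)"] n(1)
    by metis
  have min1: "degree G \<le> degree H" if "good H" for H
    using n(2) [OF that] G(2) by simp
  have min2: "degree (lead_coeff G) \<le> degree (lead_coeff H)" if "good H" "degree H = degree G" for H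
    using min2' that G(2) by simp
  define W where "W = {p\<in>Z. eval2 G p = 0}"
  have "infinite W" "G \<noteq> 0"
    using G by (auto simp: good_def W_def)
  have goodI: "good H" if "H \<noteq> 0" "infinite V" "V \<subseteq> Z" "\<And>p. p \<in> V \<Longrightarrow> eval2 H p = 0" for H V
    using that unfolding good_def by (metis (mono_tags, lifting) infinite_super mem_Collect_eq subset_eq)
  have Gdvd: "G dvd h" if V: "infinite V" "V \<subseteq> W" and h: "\<And>p. p \<in> V \<Longrightarrow> eval2 h p = 0" for h V
  proof (cases "degree G = 0")
    \<comment> \<open>If G lies in K[y], its linear factors y - a could not be cancelled after
      pseudo-division. Instead, infinitely many points of V share one line y = a, so y - a is itself
      \<open>good\<close>, and minimality makes G a unit multiple of it.\<close>
    case True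
    then obtain g where g: "G = [:g:]"
      by (metis degree_eq_zeroE)
    have "g \<noteq> 0"
      using \<open>G \<noteq> 0\<close> g by simp
    have "fst ` V \<subseteq> {a. poly g a = 0}"
      using V by (auto simp: W_def g)
    then have "finite (fst ` V)"
      using \<open>g \<noteq> 0\<close> poly_roots_finite finite_subset by blast
    then obtain v where v: "v \<in> V" "infinite {p\<in>V. fst p = fst v}"
      using pigeonhole_infinite [of V fst] V(1) by blast
    define a where "a = fst v"
    let ?A = "{p\<in>V. fst p = a}"
    have "good [:[:-a, 1:]:]"
      by (rule goodI [of _ ?A]) (use v V in \<open>auto simp: a_def W_def\<close>)
    then have "degree g \<le> 1"
      using min2 [of "[:[:-a, 1:]:]"] g by simp
    have "poly g a = 0"
      using v V by (auto simp: W_def g a_def)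
    then obtain k where k: "g = [:-a, 1:] * k"
      by (auto simp: poly_eq_0_iff_dvd elim: dvdE)
    have "k \<noteq> 0"
      using k \<open>g \<noteq> 0\<close> by auto
    then have "degree k = 0"
      using k \<open>degree g \<le> 1\<close> by (simp add: degree_mult_eq del: mult_pCons_left)
    then have "is_unit k"
      using \<open>k \<noteq> 0\<close> by (simp add: is_unit_iff_degree)
    then have "[:g:] dvd [:[:-a, 1:]:]"
      using k by (simp del: mult_pCons_left)
    moreover have "[:[:-a, 1:]:] dvd h"
    proof -
      have "inj_on snd ?A"
        by (auto simp: inj_on_def)
      then have "infinite (snd ` ?A)"
        using v(2) finite_imageD unfolding a_def by blast
      moreover have "snd ` ?A \<subseteq> {b. poly (eval_inner a h) b = 0}"
        using h by (auto simp: poly_eval_inner)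
      ultimately have "eval_inner a h = 0"
        using poly_roots_finite finite_subset by blast
      then show ?thesis
        by (simp add: eval_inner_eq_0_iff)
    qed
    ultimately show ?thesis
      using g dvd_trans by blast
  next
    case False
    obtain q r where qr: "pseudo_divmod h G = (q, r)" by force
    define c where "c = lead_coeff G ^ (Suc (degree h) - degree G)"
    have eq: "smult c h = G * q + r" and r: "r = 0 \<or> degree r < degree G"
      using pseudo_divmod [OF \<open>G \<noteq> 0\<close> qr] by (simp_all add: c_def)
    have "r = 0"
    proof (rule ccontr)
      assume "r \<noteq> 0"
      have "eval2 r p = 0" if "p \<in> V" for p
      proof -
        have "eval2 (smult c h) p = eval2 (G * q + r) p"
          by (simp only: eq)
        then show ?thesis
          using h [OF that] that V by (auto simp: W_def)
      qed
      then have "good r"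
        using \<open>r \<noteq> 0\<close> V by (intro goodI [of r V]) (auto simp: W_def)
      then show False
        using min1 r \<open>r \<noteq> 0\<close> by force
    qed
    \<comment> \<open>A factor y - a would leave a cofactor of the same degree in z whose leading
      coefficient has smaller degree in y. By minimality neither the cofactor nor y - a is
      \<open>good\<close>, yet their zeros cover the infinite set W.\<close>
    have "\<not> [:[:-a, 1:]:] dvd G" for a
    proof
      assume "[:[:-a, 1:]:] dvd G"
      then obtain G' where G': "G = smult [:-a, 1:] G'"
        by (auto elim: dvdE)
      then have "G' \<noteq> 0" using \<open>G \<noteq> 0\<close> by auto
      have "lead_coeff G = [:-a, 1:] * lead_coeff G'"
        by (simp only: G' lead_coeff_smult)
      then have "degree (lead_coeff G) = Suc (degree (lead_coeff G'))"
        using \<open>G' \<noteq> 0\<close> by (simp add: degree_mult_eq del: mult_pCons_left)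
      moreover have "degree G' = degree G"
        by (simp add: G')
      ultimately have "\<not> good G'"
        using min2 by force
      moreover have "\<not> good [:[:-a, 1:]:]"
        using min1 False by force
      ultimately have "finite ({p\<in>Z. eval2 G' p = 0} \<union> {p\<in>Z. eval2 [:[:-a, 1:]:] p = 0})"
        using \<open>G' \<noteq> 0\<close> by (simp add: good_def)
      moreover have "W \<subseteq> {p\<in>Z. eval2 G' p = 0} \<union> {p\<in>Z. eval2 [:[:-a, 1:]:] p = 0}"
        by (auto simp: W_def G')
      ultimately show False
        using \<open>infinite W\<close> finite_subset by blast
    qed
    moreover have "c \<noteq> 0"
      using \<open>G \<noteq> 0\<close> by (simp add: c_def)
    ultimately show ?thesis
      using eq \<open>r = 0\<close> dvd_cancel_inner_factor [of c h G q] by simp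
  qed
  have "G dvd f"
    by (rule Gdvd [OF \<open>infinite W\<close>]) (use f0 in \<open>auto simp: W_def\<close>)
  then obtain H where H: "f = G * H" by (rule dvdE)
  show ?thesis
  proof (cases "infinite {p\<in>W. eval2 H p = 0}")
    case True
    then have "G dvd H"
      by (rule Gdvd) auto
    then have "G * G dvd f"
      by (simp add: H mult_dvd_mono)
    moreover obtain p where "p \<in> W"
      using infinite_imp_nonempty [OF \<open>infinite W\<close>] by blast
    ultimately show ?thesis
      unfolding W_def by blast
  next
    case False
    \<comment> \<open>H has only finitely many zeros in W; at the remaining points the singularity
      of f is inherited by G.\<close>
    define V where "V = {p\<in>W. eval2 H p \<noteq> 0}"
    have "W = V \<union> {p\<in>W. eval2 H p = 0}"
      by (auto simp: V_def)
    then have "infinite V"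
      using False \<open>infinite W\<close> by (metis finite_UnI)
    have V: "V \<subseteq> W" "V \<subseteq> Z"
      by (auto simp: V_def W_def)
    have sV: "eval2 (pderiv G) p = 0" "eval2 (map_poly pderiv G) p = 0" if "p \<in> V" for p
    proof -
      have "doubly_vanishes (G * H) p" "eval2 H p \<noteq> 0"
        using sing [of p] that V(2) by (auto simp: V_def H)
      then show "eval2 (pderiv G) p = 0" "eval2 (map_poly pderiv G) p = 0"
        using doubly_vanishes_mult by blast+
    qed
    have dz: "pderiv G = 0"
    proof (rule ccontr)
      assume "pderiv G \<noteq> 0"
      then have "degree (pderiv G) < degree G"
        by (rule degree_pderiv_less)
      moreover have "good (pderiv G)"
        using \<open>pderiv G \<noteq> 0\<close> \<open>infinite V\<close> V(2) sV(1) by (rule goodI)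
      ultimately show False
        using min1 by force
    qed
    have dy: "map_poly pderiv G = 0"
    proof (rule ccontr)
      assume nz: "map_poly pderiv G \<noteq> 0"
      \<comment> \<open>Differentiation in y need not lower the degree in z, so divisibility is
        used: the quotient has degree 0 in z, and comparing leading coefficients makes the
        derivative of \<open>lead_coeff G\<close> a nonzero multiple of \<open>lead_coeff G\<close>,
        which its degree forbids.\<close>
      have "G dvd map_poly pderiv G"
        using Gdvd [OF \<open>infinite V\<close> V(1)] sV by blast
      then obtain q where q: "map_poly pderiv G = G * q" by (rule dvdE)
      then have "q \<noteq> 0"
        using nz by auto
      moreover have "degree (map_poly pderiv G) \<le> degree G"
        by (rule degree_le) (simp add: coeff_map_poly coeff_eq_0)
      ultimately have "degree q = 0"
        using q \<open>G \<noteq> 0\<close> by (simp add: degree_mult_eq)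
      then obtain c where c: "q = [:c:]"
        by (metis degree_eq_zeroE)
      have "pderiv (lead_coeff G) = c * lead_coeff G"
        using arg_cong [OF q, of "\<lambda>P. coeff P (degree G)"] by (simp add: c coeff_map_poly)
      moreover have "c \<noteq> 0" "lead_coeff G \<noteq> 0"
        using c \<open>q \<noteq> 0\<close> \<open>G \<noteq> 0\<close> by auto
      ultimately have d: "degree (pderiv (lead_coeff G)) = degree c + degree (lead_coeff G)"
          "pderiv (lead_coeff G) \<noteq> 0"
        by (simp_all add: degree_mult_eq)
      then show False
        using degree_pderiv_less [of "lead_coeff G"] by simp
    qed
    have dy': "pderiv (coeff G i) = 0" for i
      using arg_cong [OF dy, of "\<lambda>P. coeff P i"] by (simp add: coeff_map_poly)
    have notconst: False if d: "degree G = 0" "degree (lead_coeff G) = 0"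
    proof -
      obtain k where k: "G = [:[:k:]:]"
        using d by (metis degree_eq_zeroE lead_coeff_pCons(2))
      obtain p where "p \<in> W"
        using infinite_imp_nonempty [OF \<open>infinite W\<close>] by blast
      then show False
        using k \<open>G \<noteq> 0\<close> by (simp add: W_def)
    qed
    show ?thesis
    proof (cases "CHAR('a) = 0")
      case True
      then have "degree G = 0" "degree (lead_coeff G) = 0"
        using dz dy' by (auto intro!: pderiv_eq_0_imp_degree_0)
      then show ?thesis
        using notconst by blast
    next
      case False
      then have p: "prime CHAR('a)"
        using prime_CHAR_semidom by blast
      \<comment> \<open>K contains all p-th roots, and the coefficients of G have zero derivative,
        so each of them is a p-th power in K[y]; hence so is G in K[y][z].\<close>
      have "\<exists>r. r ^ CHAR('a) = coeff G i" for i
      proof -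
        have "\<exists>r. r ^ CHAR('a) = coeff (coeff G i) j" for j
          using nth_root_exists [of "CHAR('a)"] False by blast
        then show ?thesis
          using pderiv_eq_0_imp_power [OF p dy'] by metis
      qed
      then obtain Q where Q: "G = Q ^ CHAR('a)"
        using pderiv_eq_0_imp_power [of G] p dz by auto
      \<comment> \<open>Q has the same zeros as G, but both minimised degrees are smaller by the
        factor p, so both are zero.\<close>
      have "Q \<noteq> 0"
        using \<open>G \<noteq> 0\<close> Q False by auto
      then have "good Q"
        using \<open>infinite W\<close> Q False by (intro goodI [of Q W]) (auto simp: W_def)
      have p2: "CHAR('a) \<ge> 2"
        using p by (rule prime_ge_2_nat)
      have "degree G = CHAR('a) * degree Q"
        using \<open>Q \<noteq> 0\<close> by (simp add: Q degree_power_eq)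
      then have "degree Q = 0" "degree G = 0"
        using min1 [OF \<open>good Q\<close>] p2 by (auto simp: not_le)
      moreover have "degree (lead_coeff G) = CHAR('a) * degree (lead_coeff Q)"
        unfolding Q lead_coeff_power using \<open>Q \<noteq> 0\<close> by (simp add: degree_power_eq)
      ultimately have "degree (lead_coeff G) = 0"
        using min2 [OF \<open>good Q\<close>] p2 by auto
      then show ?thesis
        using notconst \<open>degree G = 0\<close> by blast
    qed
  qed
qed

section \<open>Substitution and homogenisation\<close>

text \<open>Like \<open>eval3\<close>, this sends every variable other than $x_0, x_1, x_2$ to $1$, so it is a ring
  homomorphism on all of \<open>'k mpoly\<close>.\<close>

definition subst3 :: "('k::comm_ring_1 \<Rightarrow> 'r::comm_ring_1) \<Rightarrow> 'r \<Rightarrow> 'r \<Rightarrow> 'r \<Rightarrow> 'k mpoly \<Rightarrow> 'r" where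
  "subst3 h x y z F = (\<Sum>m\<in>Poly_Mapping.keys F. h (Poly_Mapping.lookup F m) *
     x ^ Poly_Mapping.lookup m 0 * y ^ Poly_Mapping.lookup m 1 * z ^ Poly_Mapping.lookup m 2)"

section \<open>Substitution as a ring homomorphism\<close>

lemma mpoly_sum_single:
  "(\<Sum>m\<in>Poly_Mapping.keys F. Poly_Mapping.single m (Poly_Mapping.lookup F m)) = F"
  by (rule poly_mapping_eqI) (auto simp: lookup_sum lookup_single when_def in_keys_iff)

lemma mpoly_induct [case_names single add]:
  fixes F :: "'k::comm_ring_1 mpoly"
  assumes "\<And>m c. P (Poly_Mapping.single m c)" and "\<And>F G. P F \<Longrightarrow> P G \<Longrightarrow> P (F + G)"
  shows "P F"
proof -
  have *: "P (\<Sum>m\<in>A. Poly_Mapping.single m (Poly_Mapping.lookup F m))" if "finite A" for A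
    using that
  proof induction
    case empty
    then show ?case using assms(1) [of 0 0] by simp
  qed (simp add: assms)
  show ?thesis
    using * [OF finite_keys [of F]] by (simp only: mpoly_sum_single)
qed

locale coefficient_hom =
  fixes h :: "'k::comm_ring_1 \<Rightarrow> 'r::comm_ring_1"
  assumes hom: "h 0 = 0" "h 1 = 1" "h (a + b) = h a + h b" "h (a * b) = h a * h b"
begin

lemma subst3_single: "subst3 h x y z (Poly_Mapping.single m c) =
    h c * x ^ Poly_Mapping.lookup m 0 * y ^ Poly_Mapping.lookup m 1 * z ^ Poly_Mapping.lookup m 2"
  by (simp add: subst3_def hom)

lemma subst3_0: "subst3 h x y z 0 = 0"
  by (simp add: subst3_def)

lemma subst3_1: "subst3 h x y z 1 = 1"
  using subst3_single [of x y z 0 1] by (simp add: hom)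

lemma subst3_add: "subst3 h x y z (F + G) = subst3 h x y z F + subst3 h x y z G"
proof -
  let ?A = "Poly_Mapping.keys F \<union> Poly_Mapping.keys G"
  have *: "subst3 h x y z H = (\<Sum>m\<in>?A. h (Poly_Mapping.lookup H m) *
     x ^ Poly_Mapping.lookup m 0 * y ^ Poly_Mapping.lookup m 1 * z ^ Poly_Mapping.lookup m 2)"
    if "Poly_Mapping.keys H \<subseteq> ?A" for H
    unfolding subst3_def by (rule sum.mono_neutral_left) (use that in \<open>auto simp: in_keys_iff hom\<close>)
  show ?thesis
    by (simp add: * keys_add lookup_add hom sum.distrib algebra_simps)
qed

lemma subst3_mult: "subst3 h x y z (F * G) = subst3 h x y z F * subst3 h x y z G"
proof (induction F rule: mpoly_induct)
  case (single m c)
  show ?case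
  proof (induction G rule: mpoly_induct)
    case (single n d)
    show ?case
      by (simp add: mult_single subst3_single hom lookup_add power_add mult_ac)
  qed (simp add: distrib_left subst3_add)
qed (simp add: distrib_right subst3_add)

lemma subst3_power: "subst3 h x y z (F ^ n) = subst3 h x y z F ^ n"
  by (induction n) (simp_all add: subst3_1 subst3_mult)

lemma subst3_sum: "subst3 h x y z (\<Sum>i\<in>A. F i) = (\<Sum>i\<in>A. subst3 h x y z (F i))"
  by (induction A rule: infinite_finite_induct) (simp_all add: subst3_0 subst3_add)

lemmas subst3_simps = subst3_0 subst3_1 subst3_add subst3_mult subst3_power subst3_sum

end

interpretation inner: coefficient_hom "\<lambda>c::'k::field. [:c:]"
  by unfold_locales (simp_all add: one_pCons)

interpretation inner2: coefficient_hom "\<lambda>c::'k::field. [:[:c:]:]"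
  by unfold_locales (simp_all add: one_pCons)

text \<open>Pullback of F along the curve parametrised by (u, v, w) in affine 3-space.\<close>

abbreviation on_curve :: "'k::field poly \<Rightarrow> 'k poly \<Rightarrow> 'k poly \<Rightarrow> 'k mpoly \<Rightarrow> 'k poly" where
  "on_curve \<equiv> subst3 (\<lambda>c. [:c:])"

definition dehom :: "'k::field mpoly \<Rightarrow> 'k poly poly" where
  "dehom = subst3 (\<lambda>c. [:[:c:]:]) 1 [:[:0, 1:]:] [:0, 1:]"

text \<open>Parametrised by (0, 1, t), which misses only the point (0, 0, 1) of the line x_0 =
  0.\<close>

definition at_infinity_line :: "'k::field mpoly \<Rightarrow> 'k poly" where
  "at_infinity_line = on_curve 0 1 [:0, 1:]"

lemmas dehom_simps = inner2.subst3_simps [where x = 1 and y = "[:[:0, 1:]:]" and z = "[:0, 1:]", folded dehom_def]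

section \<open>Pullbacks along curves and multiplicity\<close>

lemma poly_on_curve: "poly (on_curve u v w F) t = eval3 F (poly u t, poly v t, poly w t)"
  by (simp add: subst3_def eval3_def poly_sum mult.assoc)

lemma poly_dehom: "poly (dehom F) [:b:] = on_curve 1 [:0, 1:] [:b:] F"
  by (simp add: dehom_def subst3_def poly_sum)

lemma eval_inner_sum: "eval_inner a (\<Sum>i\<in>A. P i) = (\<Sum>i\<in>A. eval_inner a (P i))"
  by (rule poly_eqI) (simp add: coeff_sum poly_sum)

lemma eval_inner_1: "eval_inner a 1 = 1"
  by (simp add: one_pCons)

lemma eval_inner_power: "eval_inner a (P ^ n) = eval_inner a P ^ n"
  by (induction n) (simp_all add: eval_inner_mult eval_inner_1)

lemma eval_inner_smult: "eval_inner a (smult c P) = smult (poly c a) (eval_inner a P)"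
  by (rule poly_eqI) simp

lemma eval_inner_dehom: "eval_inner a (dehom F) = on_curve 1 [:a:] [:0, 1:] F"
  by (simp add: dehom_def subst3_def eval_inner_sum eval_inner_mult eval_inner_power
      eval_inner_smult)

lemma eval2_dehom: "eval2 (dehom F) (a, b) = eval3 F (1, a, b)"
  by (simp add: eval2_def poly_dehom poly_on_curve)

text \<open>Elements of I(p) pull back to multiples of X - t when the curve passes through p at
  parameter t, so products of k of them pull back to multiples of (X - t)^k. This turns membership
  in an ideal power into one-variable divisibility.\<close>

lemma ideal_pow3_imp_power_dvd:
  assumes "F \<in> ideal_pow3 (Ipt (poly u t, poly v t, poly w t)) k"
  shows "[:-t, 1:] ^ k dvd on_curve u v w F"
  using assms
proof (induction k arbitrary: F)
  case (Suc k)
  let ?I = "Ipt (poly u t, poly v t, poly w t)"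
  obtain A :: "nat set" and r g where F: "F = (\<Sum>i\<in>A. r i * g i)"
    and g: "\<And>i. i \<in> A \<Longrightarrow> \<exists>a b. g i = a * b \<and> a \<in> ?I \<and> b \<in> ideal_pow3 ?I k"
    using Suc.prems by (auto simp: ideal_gen3_def)
  have "[:-t, 1:] ^ Suc k dvd on_curve u v w (g i)" if i: "i \<in> A" for i
  proof -
    obtain a b where ab: "g i = a * b" "a \<in> ?I" "b \<in> ideal_pow3 ?I k"
      using g [OF i] by blast
    have "[:-t, 1:] dvd on_curve u v w a"
      using ab(2) by (simp add: poly_eq_0_iff_dvd [symmetric] poly_on_curve Ipt_def)
    moreover have "[:-t, 1:] ^ k dvd on_curve u v w b"
      using Suc.IH ab(3) by blast
    ultimately show ?thesis
      unfolding ab(1) inner.subst3_mult power_Suc by (rule mult_dvd_mono)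
  qed
  then show ?case
    unfolding F inner.subst3_sum inner.subst3_mult by (intro dvd_sum dvd_mult) blast
qed simp

section \<open>Homogeneous forms\<close>

lemma homogeneous_mult:
  assumes "homogeneous a A" "homogeneous b B"
  shows "homogeneous (a + b) (A * B)"
  unfolding homogeneous_def in_ring3_def
proof (intro conjI ballI)
  fix m assume "m \<in> Poly_Mapping.keys (A * B)"
  then obtain k l where kl: "m = k + l" "k \<in> Poly_Mapping.keys A" "l \<in> Poly_Mapping.keys B"
    using keys_mult by blast
  show "Poly_Mapping.keys m \<subseteq> {0,1,2}"
    using assms kl keys_add [of k l] unfolding homogeneous_def in_ring3_def by blast
  show "Poly_Mapping.lookup m 0 + Poly_Mapping.lookup m 1 + Poly_Mapping.lookup m 2 = a + b"
    using assms kl unfolding homogeneous_def by (simp add: lookup_add) force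
qed

lemma homogeneous_add:
  assumes "homogeneous d A" "homogeneous d B"
  shows "homogeneous d (A + B)"
  using assms keys_add [of A B] unfolding homogeneous_def in_ring3_def by blast

lemma homogeneous_uminus: "homogeneous d (- A) \<longleftrightarrow> homogeneous d A"
  by (simp add: homogeneous_def in_ring3_def keys_def)

lemma homogeneous_power: "homogeneous a A \<Longrightarrow> homogeneous (n * a) (A ^ n)"
proof (induction n)
  case 0
  then show ?case by (simp add: homogeneous_def in_ring3_def)
next
  case (Suc n)
  then show ?case by (simp add: homogeneous_mult)
qed

abbreviation var :: "nat \<Rightarrow> 'k::comm_ring_1 mpoly" where
  "var i \<equiv> Poly_Mapping.single (Poly_Mapping.single i (Suc 0)) 1"

lemma var_nonzero: "var i \<noteq> 0"
  by (simp flip: keys_eq_empty)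

lemma homogeneous_var: "i \<in> {0,1,2} \<Longrightarrow> homogeneous 1 (var i)"
  by (auto simp: homogeneous_def in_ring3_def lookup_single)

lemma homogeneous_var0_power: "homogeneous n (var 0 ^ n)"
  using homogeneous_power [OF homogeneous_var [of 0], of n] by simp

lemma homogeneous_const: "homogeneous 0 (Poly_Mapping.single 0 c)"
  by (auto simp: homogeneous_def in_ring3_def)

lemma dehom_var: "dehom (var 0) = 1" "dehom (var 1) = [:[:0, 1:]:]" "dehom (var 2) = [:0, 1:]"
  by (simp_all add: dehom_def inner2.subst3_single lookup_single one_pCons)

lemma dehom_const: "dehom (Poly_Mapping.single 0 c) = [:[:c:]:]"
  by (simp add: dehom_def inner2.subst3_single)

text \<open>The degree fixes the exponent of x_0 once those of x_1 and x_2 are known, so distinct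
  terms of a form stay distinct under dehomogenisation.\<close>

lemma homogeneous_key_eqI:
  assumes "homogeneous d F" "m \<in> Poly_Mapping.keys F" "n \<in> Poly_Mapping.keys F"
    and "Poly_Mapping.lookup m 1 = Poly_Mapping.lookup n 1" "Poly_Mapping.lookup m 2 = Poly_Mapping.lookup n 2"
  shows "m = n"
proof (rule poly_mapping_eqI)
  fix i
  have "Poly_Mapping.lookup m 0 = Poly_Mapping.lookup n 0"
    using assms unfolding homogeneous_def by (metis add_right_cancel)
  moreover have "Poly_Mapping.lookup m i = 0 \<and> Poly_Mapping.lookup n i = 0" if "i \<notin> {0,1,2}"
    using assms that unfolding homogeneous_def in_ring3_def by (meson in_keys_iff subsetD)
  ultimately show "Poly_Mapping.lookup m i = Poly_Mapping.lookup n i"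
    using assms(4,5) by (cases "i \<in> {0,1,2}") auto
qed

lemma coeff_dehom:
  assumes F: "homogeneous d F" and m: "m \<in> Poly_Mapping.keys F"
  shows "coeff (coeff (dehom F) (Poly_Mapping.lookup m 2)) (Poly_Mapping.lookup m 1) = Poly_Mapping.lookup F m"
proof -
  have mon: "[:[:c:]:] * 1 ^ l * [:[:0, 1:]:] ^ i * [:0, 1:] ^ j = monom (monom c i) j" for c :: 'a and i j l
    by (simp add: monom_altdef poly_const_pow)
  have "coeff (coeff (dehom F) (Poly_Mapping.lookup m 2)) (Poly_Mapping.lookup m 1) =
      (\<Sum>n\<in>Poly_Mapping.keys F. if n = m then Poly_Mapping.lookup F m else 0)"
    unfolding dehom_def subst3_def mon coeff_sum
    by (rule sum.cong) (use homogeneous_key_eqI [OF F _ m] in \<open>auto simp: coeff_monom\<close>)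
  then show ?thesis
    using m by simp
qed

text \<open>The coefficients of a form reappear in its dehomogenisation, so a difference with zero
  image is zero. The common degree matters: x_0 and 1 have the same image.\<close>

lemma dehom_inject:
  assumes "homogeneous d A" "homogeneous d B" "dehom A = dehom B"
  shows "A = B"
proof -
  have "dehom (A + - B) + dehom B = dehom A"
    by (simp flip: dehom_simps)
  then have "dehom (A + - B) = 0"
    using assms(3) by simp
  moreover have "homogeneous d (A + - B)"
    using assms by (intro homogeneous_add) (simp_all add: homogeneous_uminus)
  ultimately have "Poly_Mapping.keys (A + - B) = {}"
    using coeff_dehom by (metis coeff_0 in_keys_iff ex_in_conv)
  then show ?thesis
    by simp
qed

lemma dehom_nonzero: "homogeneous d F \<Longrightarrow> F \<noteq> 0 \<Longrightarrow> dehom F \<noteq> 0"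
  using dehom_inject [of d F 0] by (auto simp: dehom_simps homogeneous_def in_ring3_def)

text \<open>Constants, y and z lift directly and generate all polynomials. Lifts of degrees a and b
  are padded with powers of x_0 to degree a + b before they are added.\<close>

lemma ex_homogenization: "\<exists>d A. homogeneous d A \<and> dehom A = P"
proof -
  define lifts where "lifts P \<longleftrightarrow> (\<exists>d A. homogeneous d A \<and> dehom A = P)" for P :: "'a poly poly"
  have add: "lifts (P + Q)" if PQ: "lifts P" "lifts Q" for P Q
  proof -
    obtain a A b B where A: "homogeneous a A" "dehom A = P" and B: "homogeneous b B" "dehom B = Q"
      using PQ unfolding lifts_def by blast
    have "homogeneous (a + b) (A * var 0 ^ b + var 0 ^ a * B)"
      using A B homogeneous_var0_power by (intro homogeneous_add homogeneous_mult)
    moreover have "dehom (A * var 0 ^ b + var 0 ^ a * B) = P + Q"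
      using A B by (simp add: dehom_simps dehom_var)
    ultimately show ?thesis
      unfolding lifts_def by blast
  qed
  have mult: "lifts (P * Q)" if "lifts P" "lifts Q" for P Q
    using that homogeneous_mult dehom_simps(4) unfolding lifts_def by metis
  have c: "lifts [:[:c:]:]" for c
    using homogeneous_const dehom_const unfolding lifts_def by blast
  have "lifts [:[:0, 1:]:]" "lifts [:0, 1:]"
    using homogeneous_var [of 1] homogeneous_var [of 2] dehom_var unfolding lifts_def by blast+
  moreover have "lifts [:q:]" for q
  proof (induction q)
    case (pCons a q)
    have "[:pCons a q:] = [:[:a:]:] + [:[:0, 1:]:] * [:q:]"
      by simp
    then show ?case
      using add mult c pCons \<open>lifts [:[:0, 1:]:]\<close> by presburger
  qed (use c [of 0] in simp)
  ultimately have "lifts P"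
  proof (induction P)
    case (pCons q P)
    have "pCons q P = [:q:] + [:0, 1:] * P"
      by simp
    then show ?case
      using add mult pCons by presburger
  qed (use c [of 0] in simp)
  then show ?thesis
    by (simp add: lifts_def)
qed

text \<open>A term of F free of x_0 is determined by its exponent of x_2, so its coefficient would
  survive in the restriction to x_0 = 0.\<close>

lemma at_infinity_line_eq_0_imp:
  assumes F: "homogeneous d F" and "F \<noteq> 0" and 0: "at_infinity_line F = 0"
  obtains e B where "d = Suc e" "homogeneous e B" "F = var 0 * B"
proof -
  have pos: "Poly_Mapping.lookup m 0 > 0" if m: "m \<in> Poly_Mapping.keys F" for m
  proof (rule ccontr)
    assume m0: "\<not> Poly_Mapping.lookup m 0 > 0"
    \<comment> \<open>Since \<open>0 ^ 0 = 1\<close>, exactly the terms free of x_0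
      contribute.\<close>
    have mon: "[:c:] * 0 ^ l * 1 ^ i * [:0, 1:] ^ j = (if l = 0 then monom c j else 0)" for c :: 'a and i j l
      by (simp add: monom_altdef)
    have eq: "n = m" if n: "n \<in> Poly_Mapping.keys F" "Poly_Mapping.lookup n 0 = 0"
      "Poly_Mapping.lookup n 2 = Poly_Mapping.lookup m 2" for n
    proof (rule homogeneous_key_eqI [OF F n(1) m _ n(3)])
      show "Poly_Mapping.lookup n 1 = Poly_Mapping.lookup m 1"
        using F n m m0 unfolding homogeneous_def by (metis add_0 add_right_cancel not_gr_zero)
    qed
    have "coeff (at_infinity_line F) (Poly_Mapping.lookup m 2) =
        (\<Sum>n\<in>Poly_Mapping.keys F. if n = m then Poly_Mapping.lookup F m else 0)"
      unfolding at_infinity_line_def subst3_def mon coeff_sum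
      by (rule sum.cong) (use eq m0 in \<open>auto simp: coeff_monom\<close>)
    then show False
      using m 0 by (simp add: in_keys_iff)
  qed
  let ?x = "Poly_Mapping.single 0 (Suc 0) :: nat \<Rightarrow>\<^sub>0 nat"
  define B where "B = (\<Sum>m\<in>Poly_Mapping.keys F. Poly_Mapping.single (m - ?x) (Poly_Mapping.lookup F m))"
  have shift: "?x + (m - ?x) = m" if "m \<in> Poly_Mapping.keys F" for m
    using pos [OF that] by (intro poly_mapping_eqI) (auto simp: lookup_add lookup_minus lookup_single when_def)
  have "var 0 * B = (\<Sum>m\<in>Poly_Mapping.keys F. Poly_Mapping.single m (Poly_Mapping.lookup F m))"
    unfolding B_def sum_distrib_left by (rule sum.cong) (simp_all add: mult_single shift)
  also have "\<dots> = F"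
    by (rule mpoly_sum_single)
  finally have FB: "F = var 0 * B" ..
  obtain m where m: "m \<in> Poly_Mapping.keys F"
    using \<open>F \<noteq> 0\<close> by (metis ex_in_conv keys_eq_empty)
  then have "d > 0"
    using pos F unfolding homogeneous_def by fastforce
  then obtain e where d: "d = Suc e"
    using gr0_implies_Suc by blast
  have "homogeneous e B"
    unfolding homogeneous_def in_ring3_def
  proof (intro conjI ballI)
    fix n assume "n \<in> Poly_Mapping.keys B"
    then obtain m where m: "m \<in> Poly_Mapping.keys F" "n = m - ?x"
      unfolding B_def using keys_sum by (fastforce split: if_splits)
    then have mn: "m = ?x + n"
      using shift by simp
    have l: "Poly_Mapping.lookup m i = (if i = 0 then 1 else 0) + Poly_Mapping.lookup n i" for i
      by (simp add: mn lookup_add lookup_single when_def)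
    have "Poly_Mapping.keys n \<subseteq> Poly_Mapping.keys m"
      by (auto simp: in_keys_iff l)
    then show "Poly_Mapping.keys n \<subseteq> {0,1,2}"
      using F m(1) unfolding homogeneous_def in_ring3_def by blast
    have "Poly_Mapping.lookup m 0 + Poly_Mapping.lookup m 1 + Poly_Mapping.lookup m 2 = d"
      using F m(1) unfolding homogeneous_def by blast
    then show "Poly_Mapping.lookup n 0 + Poly_Mapping.lookup n 1 + Poly_Mapping.lookup n 2 = e"
      by (simp add: l d)
  qed
  then show ?thesis
    using that d FB by blast
qed

text \<open>Powers of x_0 cancel one at a time: on x_0 = 0 the left side vanishes and A does not, so
  B does, which makes x_0 a factor of B.\<close>

lemma square_dvd_of_var_power_mult:
  fixes F A B :: "'k::field mpoly"
  assumes "var 0 ^ n * F = A * A * B" and "at_infinity_line A \<noteq> 0" and "homogeneous b B"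
  shows "A * A dvd F"
  using assms(1,3)
proof (induction n arbitrary: B b)
  case (Suc n)
  show ?case
  proof (cases "B = 0")
    case True
    then have "F = 0"
      using Suc.prems(1) by (simp add: var_nonzero)
    then show ?thesis by simp
  next
    case False
    have "at_infinity_line (var 0 ^ Suc n * F) = 0"
      by (simp add: at_infinity_line_def inner.subst3_simps inner.subst3_single lookup_single)
    then have "at_infinity_line B = 0"
      using assms(2) unfolding Suc.prems(1) by (simp add: at_infinity_line_def inner.subst3_mult)
    then obtain e B' where B': "homogeneous e B'" "B = var 0 * B'"
      using at_infinity_line_eq_0_imp [OF Suc.prems(2) False] by metis
    have "var 0 * (var 0 ^ n * F) = var 0 * (A * A * B')"
      using Suc.prems(1) by (simp add: B'(2) mult_ac)
    then have "var 0 ^ n * F = A * A * B'"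
      by (subst (asm) mult_left_cancel) (simp_all add: var_nonzero)
    then show ?thesis
      using Suc.IH B'(1) by blast
  qed
qed simp

text \<open>A homogenisation A of G of least degree is not divisible by x_0. The factorisation of
  \<open>dehom F\<close> lifts to forms up to powers of x_0, which can then be cancelled without
  touching A * A.\<close>

lemma square_dvd_dehom_imp:
  assumes F: "homogeneous d F" "F \<noteq> 0" and "G * G dvd dehom F"
  shows "\<exists>A. in_ring3 A \<and> dehom A = G \<and> A * A dvd F"
proof -
  define lifts where "lifts a A \<longleftrightarrow> homogeneous a A \<and> dehom A = G" for a A
  obtain R where R: "dehom F = G * G * R"
    using assms(3) by (rule dvdE)
  have "dehom F \<noteq> 0"
    using F by (rule dehom_nonzero)
  then have "G \<noteq> 0"
    using R by auto
  obtain a where a: "\<exists>A. lifts a A" "\<And>e A. lifts e A \<Longrightarrow> a \<le> e"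
    using ex_homogenization [of G] ex_has_least_nat [of "\<lambda>a. \<exists>A. lifts a A" _ id]
    unfolding lifts_def by (metis id_apply)
  then obtain A where A: "homogeneous a A" "dehom A = G"
    unfolding lifts_def by blast
  have "A \<noteq> 0"
    using A \<open>G \<noteq> 0\<close> by (auto simp: dehom_simps)
  have "at_infinity_line A \<noteq> 0"
  proof
    assume "at_infinity_line A = 0"
    then obtain e B where B: "a = Suc e" "homogeneous e B" "A = var 0 * B"
      using at_infinity_line_eq_0_imp [OF A(1) \<open>A \<noteq> 0\<close>] by metis
    then have "lifts e B"
      using A(2) by (simp add: lifts_def dehom_simps dehom_var)
    then show False
      using a(2) B(1) by fastforce
  qed
  obtain b B where B: "homogeneous b B" "dehom B = R"
    using ex_homogenization by blast
  \<comment> \<open>The powers of x_0 bring both sides to degree a + a + b + d, and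
    \<open>dehom\<close> is injective on forms of one degree.\<close>
  have "var 0 ^ (a + a + b) * F = A * A * (B * var 0 ^ d)"
  proof (rule dehom_inject)
    show "homogeneous (a + a + b + d) (var 0 ^ (a + a + b) * F)"
      using homogeneous_var0_power F(1) by (rule homogeneous_mult)
    have "homogeneous ((a + a) + (b + d)) (A * A * (B * var 0 ^ d))"
      using homogeneous_var0_power A B by (intro homogeneous_mult)
    then show "homogeneous (a + a + b + d) (A * A * (B * var 0 ^ d))"
      by (simp add: add.assoc)
    show "dehom (var 0 ^ (a + a + b) * F) = dehom (A * A * (B * var 0 ^ d))"
      by (simp add: dehom_simps dehom_var A B R)
  qed
  then have "A * A dvd F"
    using square_dvd_of_var_power_mult \<open>at_infinity_line A \<noteq> 0\<close> 
      homogeneous_mult [OF B(1) homogeneous_var0_power] by blast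
  then show ?thesis
    using A unfolding homogeneous_def by blast
qed

section \<open>Finiteness of the singular locus\<close>

text \<open>A nonconstant p takes the value 1, because p - 1 has a root.\<close>

lemma ex_poly_nonzero: "\<exists>x. poly p x \<noteq> 0" if "p \<noteq> 0" for p :: "'a::alg_closed_field poly"
proof (cases "degree p = 0")
  case True
  then show ?thesis
    using that by (auto elim!: degree_eq_zeroE)
next
  case False
  then have "degree (p - 1) > 0"
    using degree_add_eq_left [of "- 1" p] by simp
  then obtain x where "poly (p - 1) x = 0"
    using alg_closed_imp_poly_has_root by blast
  then show ?thesis
    by (metis eq_iff_diff_eq_0 poly_1 poly_diff zero_neq_one)
qed

text \<open>\<open>GREATEST\<close> is meaningful only for a nonempty bounded set of exponents. The
  bound is the degree of the restriction of F to a line joining p to a point where F does not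
  vanish.\<close>

lemma ideal_pow3_mult:
  fixes F :: "'k::alg_closed_field mpoly"
  assumes F: "homogeneous d F" "F \<noteq> 0"
  shows "F \<in> ideal_pow3 (Ipt p) (mult p F)"
proof -
  have "dehom F \<noteq> 0"
    using F by (rule dehom_nonzero)
  then obtain a where "poly (lead_coeff (dehom F)) a \<noteq> 0"
    using ex_poly_nonzero by (metis leading_coeff_0_iff)
  then have "eval_inner a (dehom F) \<noteq> 0"
    by (metis coeff_eval_inner coeff_0)
  then obtain b where "poly (eval_inner a (dehom F)) b \<noteq> 0"
    using ex_poly_nonzero by blast
  then have ne: "eval3 F (1, a, b) \<noteq> 0"
    by (simp add: poly_eval_inner eval2_dehom)
  obtain x y z where p: "p = (x, y, z)"
    by (cases p)
  \<comment> \<open>The line passes through p at t = 0 and through (1, a, b) at t = 1.\<close>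
  let ?L = "on_curve [:x, 1 - x:] [:y, a - y:] [:z, b - z:] F"
  have "poly ?L 1 \<noteq> 0"
    using ne by (simp add: poly_on_curve)
  then have "?L \<noteq> 0"
    by auto
  have "k \<le> degree ?L" if "F \<in> ideal_pow3 (Ipt p) k" for k
  proof -
    have "[:-0, 1:] ^ k dvd ?L"
      by (rule ideal_pow3_imp_power_dvd) (use that p in simp)
    then have "degree ([:-0, 1 :: 'k:] ^ k) \<le> degree ?L"
      using \<open>?L \<noteq> 0\<close> by (rule dvd_imp_degree_le)
    then show ?thesis
      by (simp add: degree_power_eq)
  qed
  moreover have "F \<in> ideal_pow3 (Ipt p) 0"
    using F by (simp add: homogeneous_def)
  ultimately show ?thesis
    unfolding mult_def by (rule GreatestI_nat [rotated])
qed

lemma sing_pts_imp_square_dvd: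
  fixes F :: "'k::alg_closed_field mpoly"
  assumes "homogeneous d F" "F \<noteq> 0" and "(poly u t, poly v t, poly w t) \<in> sing_pts F"
  shows "[:-t, 1:]\<^sup>2 dvd on_curve u v w F"
proof -
  let ?m = "mult (poly u t, poly v t, poly w t) F"
  have "[:-t, 1:] ^ ?m dvd on_curve u v w F"
    using ideal_pow3_imp_power_dvd ideal_pow3_mult [OF assms(1,2)] by blast
  moreover have "[:-t, 1:]\<^sup>2 dvd [:-t, 1:] ^ ?m"
    using assms(3) by (intro le_imp_power_dvd) (simp add: sing_pts_def)
  ultimately show ?thesis
    using dvd_trans by blast
qed

lemma finite_sing_pts_affine:
  fixes F :: "'k::alg_closed_field mpoly"
  assumes F: "homogeneous d F" "F \<noteq> 0" and "reduced F"
  shows "finite {(a, b). (1, a, b) \<in> sing_pts F}" (is "finite ?Z")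
proof (rule ccontr)
  assume inf: "infinite ?Z"
  have "dehom F \<noteq> 0"
    using F by (rule dehom_nonzero)
  moreover have "doubly_vanishes (dehom F) p" if "p \<in> ?Z" for p
  proof -
    obtain a b where p: "p = (a, b)" "(1, a, b) \<in> sing_pts F"
      using \<open>p \<in> ?Z\<close> by (cases p) auto
    show ?thesis
      using sing_pts_imp_square_dvd [OF F, of 1 a "[:0, 1:]" "[:b:]"]
        sing_pts_imp_square_dvd [OF F, of 1 b "[:a:]" "[:0, 1:]"] p
      by (simp add: doubly_vanishes_def poly_dehom eval_inner_dehom)
  qed
  ultimately obtain G p where G: "G * G dvd dehom F" "eval2 G p = 0"
    using infinite_singular_imp_square_dvd inf by meson
  then obtain A where A: "in_ring3 A" "dehom A = G" "A * A dvd F"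
    using square_dvd_dehom_imp F by blast
  then obtain B where "1 = A * B"
    using \<open>reduced F\<close> unfolding reduced_def by (metis dvdE)
  then have "1 = G * dehom B"
    using A(2) by (metis dehom_simps(2,4))
  then have "eval2 (G * dehom B) p = eval2 1 p"
    by (simp only:)
  then show False
    using G(2) by (simp add: eval2_def)
qed

text \<open>Infinitely many singular points on x_0 = 0 force F = x_0 * H. On lines crossing x_0 = 0
  at these points F has a double zero, of which x_0 accounts for only one, so H vanishes there too
  and x_0^2 divides F.\<close>

lemma finite_sing_pts_at_infinity:
  fixes F :: "'k::alg_closed_field mpoly"
  assumes F: "homogeneous d F" "F \<noteq> 0" and "reduced F"
  shows "finite {c. (0, 1, c) \<in> sing_pts F}" (is "finite ?C")
proof (rule ccontr)
  assume inf: "infinite ?C"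
  have zero: "at_infinity_line H = 0" if "\<And>c. c \<in> ?C \<Longrightarrow> eval3 H (0, 1, c) = 0" for H
  proof (rule ccontr)
    assume "at_infinity_line H \<noteq> 0"
    then have "finite {c. poly (at_infinity_line H) c = 0}"
      by (rule poly_roots_finite)
    moreover have "?C \<subseteq> {c. poly (at_infinity_line H) c = 0}"
      using that by (auto simp: at_infinity_line_def poly_on_curve)
    ultimately show False
      using inf finite_subset by blast
  qed
  \<comment> \<open>The line (t, 1, c) is transversal to x_0 = 0: the form x_0 restricts to t on
    it.\<close>
  have sq: "[:0, 1:]\<^sup>2 dvd on_curve [:0, 1:] 1 [:c:] F" if "c \<in> ?C" for c
    using sing_pts_imp_square_dvd [OF F, of "[:0, 1:]" 0 1 "[:c:]"] that by simp
  have "eval3 F (0, 1, c) = 0" if "c \<in> ?C" for c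
  proof -
    have "poly (on_curve [:0, 1:] 1 [:c:] F) 0 = 0"
      using sq [OF that] by (auto simp: power2_eq_square elim!: dvdE)
    then show ?thesis
      by (simp add: poly_on_curve)
  qed
  then obtain e H where H: "homogeneous e H" "F = var 0 * H"
    using at_infinity_line_eq_0_imp [OF F] zero by metis
  have "H \<noteq> 0"
    using F(2) H(2) by auto
  have "eval3 H (0, 1, c) = 0" if "c \<in> ?C" for c
  proof -
    have "on_curve [:0, 1:] 1 [:c:] F = [:0, 1:] * on_curve [:0, 1:] 1 [:c:] H"
      by (simp add: H(2) inner.subst3_mult inner.subst3_single lookup_single)
    then have "[:0, 1:] * [:0, 1:] dvd [:0, 1:] * on_curve [:0, 1:] 1 [:c:] H"
      using sq [OF that] by (simp only: power2_eq_square)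
    then have "[:0, 1:] dvd on_curve [:0, 1:] 1 [:c:] H"
      by (subst (asm) dvd_mult_cancel_left) auto
    then have "poly (on_curve [:0, 1:] 1 [:c:] H) 0 = 0"
      by (auto elim!: dvdE)
    then show ?thesis
      by (simp add: poly_on_curve)
  qed
  then obtain H' where "H = var 0 * H'"
    using at_infinity_line_eq_0_imp [OF H(1) \<open>H \<noteq> 0\<close>] zero by metis
  then have "var 0 * var 0 dvd F"
    using H(2) by (simp add: mult.assoc)
  moreover have "in_ring3 (var 0 :: 'k mpoly)"
    by (simp add: in_ring3_def)
  ultimately obtain B :: "'k mpoly" where "1 = var 0 * B"
    using \<open>reduced F\<close> unfolding reduced_def by (metis dvdE)
  \<comment> \<open>Restriction to x_0 = 0 shows that x_0 is not a unit.\<close>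
  then have "at_infinity_line 1 = at_infinity_line (var 0 * B)"
    by simp
  then show False
    by (simp add: at_infinity_line_def inner.subst3_simps inner.subst3_single lookup_single)
qed

lemma finite_sing_pts:
  fixes F :: "'k::alg_closed_field mpoly"
  assumes "homogeneous d F" "F \<noteq> 0" "reduced F"
  shows "finite (sing_pts F)"
proof (rule finite_subset)
  show "sing_pts F \<subseteq> (\<lambda>(a, b). (1, a, b)) ` {(a, b). (1, a, b) \<in> sing_pts F} \<union>
      (\<lambda>c. (0, 1, c)) ` {c. (0, 1, c) \<in> sing_pts F} \<union> {(0, 0, 1)}"
    by (auto simp: sing_pts_def P2_def image_iff)
qed (use finite_sing_pts_affine [OF assms] finite_sing_pts_at_infinity [OF assms] in simp)

section \<open>The infimum\<close>

theorem theorem2p20: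
  fixes F :: "'k::alg_closed_field mpoly" and d :: nat
  assumes "d \<ge> 1" and "F \<noteq> 0" and "homogeneous d F"
    and "reduced F"
    and "sing_pts F \<noteq> {}"
  shows "(Hinf d F < -1 \<longleftrightarrow> card (sing_pts F) > 0 \<and> Hs d F (sing_pts F) < -1)
    \<and> (Hinf d F < -1 \<longrightarrow> (\<exists>U. U \<subseteq> sing_pts F \<and> U \<noteq> {} \<and> Hinf d F = Hs d F U))"
proof -
  define T where "T = sing_pts F"
  define q where "q p = real ((mult p F)\<^sup>2)" for p
  let ?A = "{Hs d F S | S. S \<subseteq> P2 \<and> finite S \<and> S \<noteq> {}}"
  have T: "finite T" "T \<noteq> {}" "T \<subseteq> P2"
    using finite_sing_pts assms by (auto simp: T_def sing_pts_def)
  have q0: "q p \<ge> 0" for p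
    by (simp add: q_def)
  have q_out: "q p \<le> 1" if "p \<in> P2" "p \<notin> T" for p
  proof -
    have "mult p F \<le> 1"
      using that by (auto simp: T_def sing_pts_def)
    then show ?thesis
      by (simp add: q_def power_le_one)
  qed
  have q_in: "q p \<ge> 1" if "p \<in> T" for p
    using that by (simp add: T_def sing_pts_def q_def)
  have Hs_eq: "Hs d F S = (real (d\<^sup>2) - sum q S) / real (card S)" for S
    by (simp add: Hs_def q_def)
  have Hs_less: "Hs d F S < -1 \<longleftrightarrow> real (d\<^sup>2) < (\<Sum>p\<in>S. q p - 1)" if "finite S" "S \<noteq> {}" for S
  proof -
    have "real (card S) > 0"
      using that by (simp add: card_gt_0_iff)
    then show ?thesis
      by (auto simp: Hs_eq divide_less_eq sum_subtractf)
  qed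
  have split: "sum g S = sum g (S \<inter> T) + sum g (S - T)" if "finite S" for g :: "_ \<Rightarrow> real" and S
    using that by (metis sum.Int_Diff)
  have le_T: "(\<Sum>p\<in>S. q p - 1) \<le> (\<Sum>p\<in>S \<inter> T. q p - 1)" if "S \<subseteq> P2" "finite S" for S
  proof -
    have "(\<Sum>p\<in>S - T. q p - 1) \<le> 0"
      by (rule sum_nonpos) (use q_out that in force)
    then show ?thesis
      using split [OF that(2)] by simp
  qed
  have T_mono: "(\<Sum>p\<in>S \<inter> T. q p - 1) \<le> (\<Sum>p\<in>T. q p - 1)" for S
    by (rule sum_mono2) (use T q_in in auto)
  \<comment> \<open>Let M \<ge> 0 be the sum of q - 1 over T. The numerator is at least -M - |S|,
    and dividing by |S| \<ge> 1 gives the bound -(M + 1).\<close>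
  have bdd: "bdd_below ?A"
  proof (rule bdd_belowI)
    fix x assume "x \<in> ?A"
    then obtain S where S: "x = Hs d F S" "S \<subseteq> P2" "finite S" "S \<noteq> {}"
      by blast
    have c: "real (card S) \<ge> 1"
      using S by (simp add: Suc_le_eq card_gt_0_iff)
    have "sum q S \<le> (\<Sum>p\<in>T. q p - 1) + real (card S)"
      using le_T [OF S(2,3)] T_mono [of S] by (simp add: sum_subtractf)
    moreover have "(\<Sum>p\<in>T. q p - 1) \<ge> 0"
      by (rule sum_nonneg) (use q_in in force)
    then have "(\<Sum>p\<in>T. q p - 1) * 1 \<le> (\<Sum>p\<in>T. q p - 1) * real (card S)"
      using c by (intro mult_left_mono)
    moreover have "0 \<le> real (d\<^sup>2)"
      by simp
    moreover have "- (x + 1) * y = - (x * y) - y" for x y :: real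
      by (simp add: algebra_simps)
    ultimately have "- ((\<Sum>p\<in>T. q p - 1) + 1) * real (card S) \<le> real (d\<^sup>2) - sum q S"
      by (smt (verit))
    then show "- ((\<Sum>p\<in>T. q p - 1) + 1) \<le> x"
      using c by (simp add: S(1) Hs_eq le_divide_eq)
  qed
  have inA: "Hs d F S \<in> ?A" if "S \<subseteq> T" "S \<noteq> {}" for S
    using that T finite_subset by blast
  have ex_subset: "\<exists>U\<subseteq>T. U \<noteq> {} \<and> Hs d F U \<le> Hs d F S"
    if S: "S \<subseteq> P2" "finite S" "S \<noteq> {}" "Hs d F S < -1" for S
  proof (intro exI conjI)
    \<comment> \<open>Each discarded point lowers the numerator by at most 1, whereas the quotient
      over the points kept is already at most -1, so discarding does not raise it.\<close>
    let ?U = "S \<inter> T"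
    have *: "real (d\<^sup>2) < (\<Sum>p\<in>?U. q p - 1)"
      using Hs_less S le_T [of S] by fastforce
    then show "?U \<noteq> {}"
      by auto
    then have u: "real (card ?U) > 0"
      using S(2) by (simp add: card_gt_0_iff)
    have cS: "real (card S) = real (card ?U) + real (card (S - T))"
      using split [OF S(2), of "\<lambda>_. 1"] by simp
    define v where "v = real (card (S - T))"
    have v: "v \<ge> 0" "sum q (S - T) \<le> v"
      using sum_bounded_above [of "S - T" q 1] q_out S by (auto simp: v_def)
    define D where "D = sum q ?U - real (d\<^sup>2)"
    have D: "D \<ge> real (card ?U)"
      using * by (simp add: D_def sum_subtractf)
    \<comment> \<open>This is the desired inequality of quotients after clearing the denominators
      \<open>card ?U\<close> and \<open>card ?U + v\<close> and cancelling.\<close>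
    have "sum q (S - T) * real (card ?U) \<le> v * D"
      using v D u by (intro mult_mono) (auto intro: sum_nonneg q0)
    then have "- D * (real (card ?U) + v) \<le> (- D - sum q (S - T)) * real (card ?U)"
      by (simp add: algebra_simps)
    then have "- D / real (card ?U) \<le> (- D - sum q (S - T)) / (real (card ?U) + v)"
      using u v by (simp add: divide_le_eq le_divide_eq) (simp add: field_simps)
    then show "Hs d F ?U \<le> Hs d F S"
      by (simp add: Hs_eq D_def split [OF S(2), of q] cS v_def algebra_simps)
  qed simp
  have less_imp: "\<exists>S. S \<subseteq> P2 \<and> finite S \<and> S \<noteq> {} \<and> Hs d F S < -1" if "Hinf d F < -1"
  proof -
    have "?A \<noteq> {}"
      using inA [of T] T by blast
    then obtain x where "x \<in> ?A" "x < -1"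
      using \<open>Hinf d F < -1\<close> unfolding Hinf_def by (meson cInf_lessD)
    then show ?thesis
      by blast
  qed
  have "Hs d F T < -1" if lt: "Hinf d F < -1"
  proof -
    obtain S where S: "S \<subseteq> P2" "finite S" "S \<noteq> {}" "Hs d F S < -1"
      using less_imp [OF lt] by blast
    then have "real (d\<^sup>2) < (\<Sum>p\<in>T. q p - 1)"
      using Hs_less [of S] le_T [of S] T_mono [of S] by linarith
    then show ?thesis
      using Hs_less T by blast
  qed
  moreover have "Hinf d F \<le> Hs d F T"
    unfolding Hinf_def by (rule cInf_lower [OF inA bdd]) (use T in auto)
  moreover have "card T > 0"
    using T by (simp add: card_gt_0_iff)
  moreover have "\<exists>U. U \<subseteq> T \<and> U \<noteq> {} \<and> Hinf d F = Hs d F U" if lt: "Hinf d F < -1"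
  proof -
    let ?B = "{U. U \<subseteq> T \<and> U \<noteq> {}}"
    have "finite ?B" "?B \<noteq> {}"
      using T by auto
    then obtain U where "is_arg_min (Hs d F) (\<lambda>U. U \<in> ?B) U"
      using ex_is_arg_min_if_finite by blast
    then have U: "U \<subseteq> T" "U \<noteq> {}" and min: "\<And>V. V \<subseteq> T \<Longrightarrow> V \<noteq> {} \<Longrightarrow> Hs d F U \<le> Hs d F V"
      by (simp_all add: is_arg_min_linorder)
    obtain S0 where S0: "S0 \<subseteq> P2" "finite S0" "S0 \<noteq> {}" "Hs d F S0 < -1"
      using less_imp [OF lt] by blast
    have "Hs d F U < -1"
      using ex_subset [OF S0] min S0(4) by (meson le_less_trans order_trans)
    have "Hs d F U \<le> Hs d F S" if "S \<subseteq> P2" "finite S" "S \<noteq> {}" for S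
    proof (cases "Hs d F S < -1")
      case True
      then show ?thesis
        using ex_subset [OF that] min by (meson order_trans)
    next
      \<comment> \<open>Sets with value at least -1 cannot compete, because the value at U lies
        below -1.\<close>
      case False
      then show ?thesis
        using \<open>Hs d F U < -1\<close> by linarith
    qed
    then have "Hinf d F = Hs d F U"
      unfolding Hinf_def using inA [OF U(1,2)] by (intro cInf_eq_minimum) auto
    then show ?thesis
      using U by blast
  qed
  ultimately show ?thesis
    unfolding T_def by force
qed

end
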